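(* Let $d\ge 14$ be an integer satisfying $d\equiv 14\pmod{4620}$, and put $n=(3^d-1)/2$. Then the APN permutations $F_{k,c,s}$ of $\mathbb Z_n$ have order $n$ for which none of $$n-1,\quad n+1,\quad n+2,\quad n+3,\quad n+4$$ is a prime power. Moreover, $n\neq 2p$ for every prime $p$.
   Context: $\mathbb Z_n=\mathbb Z/n\mathbb Z$. A map $F:\mathbb Z_n\to\mathbb Z_n$ is APN if $\max_{u\neq 0,\,v}\#\{x: F(x+u)-F(x)=v\}=2$. The order of a permutation of $\mathbb Z_n$ here means the order $n$ of its domain. For $d\ge2$, $s\ge1$ with $\gcd(s,d)=1$, $n=(3^d-1)/2$, $c\in\mathbb F_{3^d}^*$ with $-c$ a nonsquare, a positive integer $k$ with $\gcd(k,n)=1$, and a primitive element $\alpha$ of $\mathbb F_{3^d}$, the APN permutation $F_{k,c,s}$ of $\mathbb Z_n$ is defined by letting $F_{k,c,s}(i)$ be the unique $j\in\mathbb Z_n$ with $(\alpha^i)^{k3^s}+c(\alpha^i)^k\in\{\alpha^j,-\alpha^j\}$. *)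

theory Defs
  imports "HOL-Number_Theory.Number_Theory"
begin

abbreviation Zmod :: "nat \<Rightarrow> int ring" where
  "Zmod n \<equiv> residue_ring (int n)"

text \<open>
  The set below is finite, and it is nonempty for \<open>n \<ge> 2\<close>; \<open>n = 1\<close> (no \<open>u \<noteq> 0\<close>) is outside the
  intended range.
\<close>
definition APN :: "nat \<Rightarrow> (int \<Rightarrow> int) \<Rightarrow> bool" where
  "APN n F \<longleftrightarrow>
     F \<in> carrier (Zmod n) \<rightarrow> carrier (Zmod n) \<and>
     Max {card {x \<in> carrier (Zmod n). F (x \<oplus>\<^bsub>Zmod n\<^esub> u) \<ominus>\<^bsub>Zmod n\<^esub> F x = v} | u v.
            u \<in> carrier (Zmod n) - {\<zero>\<^bsub>Zmod n\<^esub>} \<and> v \<in> carrier (Zmod n)} = 2"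

definition APN_permutation :: "nat \<Rightarrow> (int \<Rightarrow> int) \<Rightarrow> bool" where
  "APN_permutation n F \<longleftrightarrow>
     bij_betw F (carrier (Zmod n)) (carrier (Zmod n)) \<and> APN n F"

definition is_square_in :: "('a, 'b) ring_scheme \<Rightarrow> 'a \<Rightarrow> bool" where
  "is_square_in K a \<longleftrightarrow> (\<exists>y \<in> carrier K. a = y \<otimes>\<^bsub>K\<^esub> y)"

definition primitive_element :: "('a, 'b) ring_scheme \<Rightarrow> 'a \<Rightarrow> bool" where
  "primitive_element K \<alpha> \<longleftrightarrow>
     \<alpha> \<in> carrier (mult_of K) \<and> generate (mult_of K) {\<alpha>} = carrier (mult_of K)"

text \<open>
  \<open>K\<close> plays the role of the field with \<open>3 ^ d\<close> elements and \<open>n = (3 ^ d - 1) div 2\<close>. Classes of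
  \<open>\<int>/n\<int>\<close> are given by their representatives in \<open>{0..<n}\<close>. Other representatives would give the
  same value: a primitive \<open>\<alpha>\<close> has order \<open>2 * n\<close>, so \<open>\<alpha> ^ n = - 1\<close>.
\<close>
definition apn_F ::
  "nat \<Rightarrow> ('a, 'b) ring_scheme \<Rightarrow> 'a \<Rightarrow> nat \<Rightarrow> 'a \<Rightarrow> nat \<Rightarrow> int \<Rightarrow> int" where
  "apn_F n K \<alpha> k c s i =
     (THE j. j \<in> carrier (Zmod n) \<and>
        ((\<alpha> [^]\<^bsub>K\<^esub> i) [^]\<^bsub>K\<^esub> (k * 3 ^ s)) \<oplus>\<^bsub>K\<^esub> (c \<otimes>\<^bsub>K\<^esub> ((\<alpha> [^]\<^bsub>K\<^esub> i) [^]\<^bsub>K\<^esub> k))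
          \<in> {\<alpha> [^]\<^bsub>K\<^esub> j, \<ominus>\<^bsub>K\<^esub> (\<alpha> [^]\<^bsub>K\<^esub> j)})"

end

theory Submission
  imports Defs
begin

text \<open>
  The proof has two independent parts.

  \<^bold>\<open>The maps are APN permutations.\<close> Let \<open>K\<close> be the field with \<open>3\<^sup>d = 2n + 1\<close> elements. The
  discrete logarithm identifies \<open>\<int>/n\<close> with \<open>K\<^sup>* / {\<plusminus>1}\<close>, and under this identification
  \<open>F\<close> is the \<open>k\<close>-th power followed by \<open>L(y) = y\<^sup>q + c y\<close> with \<open>q = 3\<^sup>s\<close>. The power map is
  bijective on the quotient because \<open>k\<close> is prime to \<open>n\<close>. The map \<open>L\<close> is additive, since \<open>K\<close> has
  characteristic 3, and \<open>L(y) = 0\<close> with \<open>y \<noteq> 0\<close> would make \<open>-c = y\<^bsup>q-1\<^esup>\<close> a square, \<open>q - 1\<close>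
  being even; so \<open>L\<close> is injective and passes to the quotient (\<open>lin_class\<close>).

  For the difference equation write \<open>a \<noteq> \<plusminus>1\<close> for the \<open>k\<close>-th power of the nonzero shift and \<open>b\<close> for the
  class of the prescribed difference. A solution is a class \<open>\<plusminus>y\<close> with \<open>L(a y) = \<plusminus>b L(y)\<close>. For each
  of the two signs this equation has the form \<open>A y\<^sup>q = B y\<close>, which determines \<open>y\<^bsup>q-1\<^esup>\<close>. Since
  \<open>gcd(s, d) = 1\<close>, the only elements with \<open>z\<^sup>q = z \<noteq> 0\<close> are \<open>\<plusminus>1\<close>, so each sign contributes at
  most one class (\<open>lin_scaling_unique\<close>) and there are at most two solutions. The
  value 2 is attained for a general reason (\<open>APN_permutationI\<close>): \<open>x \<mapsto> F(x + 1) - F(x)\<close> never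
  takes the value 0 when \<open>F\<close> is injective, so by the pigeonhole principle it takes some value twice.

  \<^bold>\<open>The arithmetic of n.\<close> Each of \<open>n - 1\<close>, \<open>n + 1\<close>, \<open>n + 2\<close>, \<open>n + 3\<close>, \<open>n + 4\<close> is divisible exactly once by
  a small prime, namely by 3, 5, 3, 7 and 11 respectively, and is larger than that prime. The
  residue of \<open>n\<close> modulo 9 is 4 for every \<open>d \<ge> 2\<close>. Its residues modulo 25, 49 and 121 depend only on
  \<open>d\<close> modulo 20, 42 and 5, the orders of 3 for these moduli; these orders divide 4620, so the residues
  are those for \<open>d = 14\<close>. Likewise \<open>n\<close> is
  divisible by 4 and larger than 4, and is therefore not twice a prime.
\<close>

section \<open>Arithmetic of $(3^d-1)/2$ and its neighbours\<close>

text \<open>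
  In a prime power divisible by \<open>p\<close> the exponent of \<open>p\<close> is 1 only if the number is \<open>p\<close> itself. Giving
  the residue modulo \<open>p\<^sup>2\<close> encodes both divisibility by \<open>p\<close> and non-divisibility by \<open>p\<^sup>2\<close>.
\<close>
lemma not_primepow_if_exactly_divisible:
  fixes p m r :: nat
  assumes "prime p" "m mod p\<^sup>2 = r" "p dvd r" "r \<noteq> 0" "m \<noteq> p"
  shows "\<not> primepow m"
proof
  assume "primepow m"
  then obtain q k where qk: "prime q" "k > 0" "m = q ^ k"
    by (auto simp: primepow_def)
  have "p dvd m"
    using assms(2,3) by (metis dvd_mod_iff dvd_triv_left power2_eq_square)
  then have "p = q"
    using assms(1) qk by (metis prime_dvd_power primes_dvd_imp_eq)
  moreover have "\<not> p\<^sup>2 dvd m"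
    using assms(2,4) by (auto simp: dvd_eq_mod_eq_0)
  then have "k < 2"
    using qk \<open>p = q\<close> by (meson le_imp_power_dvd not_less)
  ultimately show False
    using qk assms(5) by (cases "k = 1") auto
qed

text \<open>
  Since 3 has order dividing 4620 modulo \<open>2 * N\<close>, the power \<open>3 ^ d\<close> has the same residue there as
  \<open>3 ^ 14\<close>. Working modulo \<open>2 * N\<close> instead of \<open>N\<close> makes the residue survive the halving.
\<close>
lemma half_three_power_mod:
  fixes d r N m :: nat
  assumes d: "d \<ge> 14" "[d = 14] (mod 4620)" and r: "r dvd 4620" "3 ^ r mod (2 * N) = 1"
    and m: "3 ^ 14 mod (2 * N) = 2 * m + 1" "N > 0"
  shows "(3 ^ d - 1) div 2 mod N = m"
proof -
  have "4620 dvd d - 14"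
    using d by (metis cong_altdef_nat)
  then obtain t where "d - 14 = r * t"
    using r(1) by (meson dvd_def dvd_trans)
  then have "(3::nat) ^ d = 3 ^ 14 * (3 ^ r) ^ t"
    using d(1) by (metis le_add_diff_inverse power_add power_mult)
  moreover have "[3 ^ 14 * (3 ^ r) ^ t = 3 ^ 14 * 1 ^ t] (mod 2 * N)"
    using r(2) by (intro cong_mult cong_pow) (auto simp: cong_def)
  ultimately have "3 ^ d mod (2 * N) = 2 * m + 1"
    using m(1) by (simp only: cong_def power_one mult_1_right)
  then have "3 ^ d = 2 * N * (3 ^ d div (2 * N)) + (2 * m + 1)"
    by (metis mult_div_mod_eq)
  then have "(3 ^ d - 1) div 2 = N * (3 ^ d div (2 * N)) + m"
    by simp
  moreover have "2 * m + 1 < 2 * N"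
    using m by (metis mod_less_divisor nat_0_less_mult_iff zero_less_numeral)
  ultimately show ?thesis by simp
qed

lemma half_three_power_bounds:
  fixes d n :: nat
  assumes "d \<ge> 14" "n = (3 ^ d - 1) div 2"
  shows "n > 100" "3 ^ d = 2 * n + 1" "n mod 9 = 4"
proof -
  have "odd ((3::nat) ^ d)" by simp
  then show X: "3 ^ d = 2 * n + 1"
    unfolding assms(2) by (metis add_diff_cancel_right' nonzero_mult_div_cancel_left oddE zero_neq_numeral)
  have "(3::nat) ^ 14 \<le> 3 ^ d"
    using assms(1) by (intro power_increasing) auto
  then show "n > 100"
    unfolding X by simp
  \<comment> \<open>3 is not invertible modulo 9, so this residue comes from the factor \<open>3\<^sup>2\<close> of the power.\<close>
  have "odd ((3::nat) ^ (d - 2))" by simp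
  then obtain j where j: "(3::nat) ^ (d - 2) = 2 * j + 1" by (rule oddE)
  have "d = 2 + (d - 2)" using assms(1) by simp
  then have "(3::nat) ^ d = 3 ^ 2 * 3 ^ (d - 2)" by (metis power_add)
  then have "n = 9 * j + 4" unfolding X j by simp
  then show "n mod 9 = 4" by simp
qed

lemma mod_add_const:
  fixes n a N r :: nat
  assumes "n mod N = r"
  shows "(n + a) mod N = (r + a) mod N"
  using assms by (metis mod_add_left_eq)

lemma half_three_power_neighbours_not_primepow:
  fixes d n :: nat
  assumes "d \<ge> 14" and "[d = 14] (mod 4620)" and n: "n = (3 ^ d - 1) div 2"
  shows "\<forall>q \<in> {n - 1, n + 1, n + 2, n + 3, n + 4}. \<not> primepow q"
proof -
  note bounds = half_three_power_bounds[OF assms(1) n]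
  have n9: "n mod 9 = 4" by (rule bounds)
  \<comment> \<open>The exponents 20, 42 and 5 are the orders of 3 modulo 25, 49 and 121.\<close>
  have n25: "n mod 25 = 9"
    unfolding n by (rule half_three_power_mod[OF assms(1,2), of 20]) simp_all
  have n49: "n mod 49 = 39"
    unfolding n by (rule half_three_power_mod[OF assms(1,2), of 42]) simp_all
  have n121: "n mod 121 = 40"
    unfolding n by (rule half_three_power_mod[OF assms(1,2), of 5]) simp_all
  have "n = 9 * (n div 9) + 4"
    using n9 by (metis mult_div_mod_eq)
  then have "n - 1 = 3 + 9 * (n div 9)" by simp
  then have "(n - 1) mod 9 = 3" by (simp only: mod_mult_self2) simp
  then have "\<not> primepow (n - 1)"
    using bounds by (intro not_primepow_if_exactly_divisible[of 3 _ 3]) simp_all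
  moreover have "\<not> primepow (n + 1)"
    using bounds mod_add_const[OF n25, of 1]
    by (intro not_primepow_if_exactly_divisible[of 5 _ 10]) simp_all
  moreover have "\<not> primepow (n + 2)"
    using bounds mod_add_const[OF n9, of 2]
    by (intro not_primepow_if_exactly_divisible[of 3 _ 6]) simp_all
  moreover have "\<not> primepow (n + 3)"
    using bounds mod_add_const[OF n49, of 3]
    by (intro not_primepow_if_exactly_divisible[of 7 _ 42]) simp_all
  moreover have "prime (11::nat)"
    by (simp add: prime_nat_numeral_eq)
  then have "\<not> primepow (n + 4)"
    using bounds mod_add_const[OF n121, of 4]
    by (intro not_primepow_if_exactly_divisible[of 11 _ 44]) simp_all
  ultimately show ?thesis by blast
qed

lemma half_three_power_neq_two_prime:
  fixes d n p :: nat
  assumes "d \<ge> 14" and "[d = 14] (mod 4620)" and n: "n = (3 ^ d - 1) div 2" and "prime p"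
  shows "n \<noteq> 2 * p"
proof
  assume np: "n = 2 * p"
  have "n mod 4 = 0"
    unfolding n by (rule half_three_power_mod[OF assms(1,2), of 2]) simp_all
  then have "even p" unfolding np by presburger
  then have "p = 2" using assms(4) by (metis primes_dvd_imp_eq two_is_prime_nat)
  then show False
    using np half_three_power_bounds(1)[OF assms(1) n] by simp
qed

section \<open>Frobenius powers in a field with $3^d$ elements\<close>

lemma finite_carrier_if_order_pos: "order R > 0 \<Longrightarrow> finite (carrier R)"
  unfolding order_def by (rule card_ge_0_finite)

lemma (in domain) pow_nonzero:
  assumes "x \<in> carrier R" "x \<noteq> \<zero>"
  shows "x [^] (m::nat) \<noteq> \<zero>"
  using assms by (induction m) (auto simp: integral_iff)

locale char3_field = field R for R (structure) +
  fixes d :: nat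
  assumes order_eq: "order R = 3 ^ d"
begin

text \<open>
  The additive group has \<open>3 ^ d\<close> elements, so \<open>3 ^ d\<close> times \<open>\<one>\<close> vanishes. This element is
  the \<open>d\<close>-th power of \<open>\<one> \<oplus> \<one> \<oplus> \<one>\<close>, which vanishes too because there are no zero divisors.
\<close>
lemma three_zero:
  assumes "x \<in> carrier R"
  shows "x \<oplus> x \<oplus> x = \<zero>"
proof -
  define t where "t = [(3::nat)] \<cdot> \<one>"
  have t: "t \<in> carrier R" by (simp add: t_def)
  have "[((3::nat) ^ j)] \<cdot> \<one> = t [^] j" for j
  proof (induction j)
    case 0
    show ?case by (simp add: add.nat_pow_Suc)
  next
    case (Suc j)
    have "[((3::nat) ^ Suc j)] \<cdot> \<one> = [(3::nat)] \<cdot> ([((3::nat) ^ j)] \<cdot> \<one>)"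
      by (simp add: add.nat_pow_pow mult.commute)
    also have "\<dots> = [(3::nat)] \<cdot> (\<one> \<otimes> t [^] j)"
      using t by (simp add: Suc.IH)
    also have "\<dots> = t \<otimes> t [^] j"
      using t unfolding t_def by (intro add_pow_ldistr[symmetric]) auto
    finally show ?case
      using t by (simp add: m_comm)
  qed
  moreover have "[((3::nat) ^ d)] \<cdot> \<one> = \<zero>"
    using add.pow_order_eq_1[of \<one>] by (simp add: order_eq[symmetric] order_def)
  ultimately have "t [^] d = \<zero>" by simp
  then have "t = \<zero>" using t
    by (induction d) (auto simp: integral_iff)
  have "x \<oplus> x \<oplus> x = (\<one> \<oplus> \<one> \<oplus> \<one>) \<otimes> x"
    using assms by algebra
  also have "\<one> \<oplus> \<one> \<oplus> \<one> = t"
    by (simp add: t_def numeral_3_eq_3 add.nat_pow_Suc)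
  finally show ?thesis
    using assms \<open>t = \<zero>\<close> by simp
qed

lemma frobenius_diff:
  assumes "x \<in> carrier R" "y \<in> carrier R"
  shows "(x \<ominus> y) [^] ((3::nat) ^ s) = x [^] ((3::nat) ^ s) \<ominus> y [^] ((3::nat) ^ s)"
proof (induction s)
  case 0
  show ?case using assms by simp
next
  case (Suc s)
  have cube: "(u \<ominus> v) [^] (3::nat) = u [^] (3::nat) \<ominus> v [^] (3::nat)"
    if u: "u \<in> carrier R" and v: "v \<in> carrier R" for u v
  proof -
    let ?A = "u \<otimes> u \<otimes> v" and ?B = "u \<otimes> v \<otimes> v"
    have "(u \<ominus> v) [^] (3::nat) =
        (u [^] (3::nat) \<ominus> v [^] (3::nat)) \<oplus> ((?B \<oplus> ?B \<oplus> ?B) \<ominus> (?A \<oplus> ?A \<oplus> ?A))"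
      using u v unfolding numeral_3_eq_3 nat_pow_Suc nat_pow_0 by algebra
    then show ?thesis
      using u v by (simp add: three_zero minus_eq)
  qed
  show ?case
    using assms by (simp add: mult.commute[of 3] nat_pow_pow[symmetric] Suc.IH cube)
qed

lemma odd_pow_uminus:
  assumes "x \<in> carrier R"
  shows "(\<ominus> x) [^] ((3::nat) ^ s) = \<ominus> (x [^] ((3::nat) ^ s))"
  using frobenius_diff[of \<zero> x s] assms by (simp add: minus_eq nat_pow_zero)

text \<open>
  Besides \<open>z \<mapsto> z ^ 3 ^ s\<close>, the map \<open>z \<mapsto> z ^ 3 ^ d\<close> fixes \<open>z\<close>, being the identity on the field. As
  \<open>s\<close> and \<open>d\<close> are coprime, iterating the two shows that \<open>z ^ 3 = z\<close>.
\<close>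
lemma frobenius_fixed:
  assumes z: "z \<in> carrier R" "z \<noteq> \<zero>" and s: "s \<ge> 1" "coprime s d"
    and fixed: "z [^] ((3::nat) ^ s) = z"
  shows "z \<in> {\<one>, \<ominus> \<one>}"
proof -
  interpret M: group "mult_of R" by (rule field_mult_group)
  have "z [^] (3 ^ d - 1 :: nat) = \<one>"
    using M.pow_order_eq_1[of z] z order_mult_of[OF finite_carrier_if_order_pos]
    by (simp add: order_eq nat_pow_mult_of)
  then have "z [^] Suc (3 ^ d - 1) = z"
    unfolding nat_pow_Suc using z by simp
  moreover have "Suc (3 ^ d - 1) = 3 ^ d" by simp
  ultimately have d: "z [^] ((3::nat) ^ d) = z" by metis
  have iter: "z [^] ((3::nat) ^ (r * j)) = z" if "z [^] ((3::nat) ^ r) = z" for r j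
  proof (induction j)
    case (Suc j)
    have "z [^] ((3::nat) ^ (r * Suc j)) = (z [^] ((3::nat) ^ (r * j))) [^] ((3::nat) ^ r)"
      using z by (simp add: nat_pow_pow power_add mult.commute)
    then show ?case using Suc that by simp
  qed (use z in simp)
  obtain i j where ij: "s * i = d * j + 1"
    using bezout_nat[of s d] s by auto
  have "z [^] (3::nat) = (z [^] ((3::nat) ^ (d * j))) [^] (3::nat)"
    using iter[OF d, of j] by simp
  also have "\<dots> = z [^] ((3::nat) ^ (s * i))"
    using z unfolding ij by (simp add: nat_pow_pow mult.commute)
  also have "\<dots> = z" by (rule iter[OF fixed])
  finally have "z \<otimes> z \<otimes> z = \<one> \<otimes> z"
    using z by (simp add: numeral_3_eq_3)
  then have "z \<otimes> z = \<one>"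
    using z m_rcancel[of z "z \<otimes> z" \<one>] by simp
  then show ?thesis using square_eq_one[OF z(1)] by auto
qed

text \<open>The linearized binomial \<open>X\<^sup>q + c X\<close> with \<open>q = 3 ^ s\<close>.\<close>
definition lin :: "nat \<Rightarrow> 'a \<Rightarrow> 'a \<Rightarrow> 'a" where
  "lin s c y = y [^] ((3::nat) ^ s) \<oplus> c \<otimes> y"

lemma lin_closed [simp]:
  "c \<in> carrier R \<Longrightarrow> y \<in> carrier R \<Longrightarrow> lin s c y \<in> carrier R"
  by (simp add: lin_def)

lemma lin_diff:
  assumes "c \<in> carrier R" "x \<in> carrier R" "y \<in> carrier R"
  shows "lin s c (x \<ominus> y) = lin s c x \<ominus> lin s c y"
proof -
  have "lin s c (x \<ominus> y) = (x [^] ((3::nat) ^ s) \<ominus> y [^] ((3::nat) ^ s)) \<oplus> c \<otimes> (x \<ominus> y)"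
    using assms by (simp add: lin_def frobenius_diff)
  also have "\<dots> = lin s c x \<ominus> lin s c y"
    using assms nat_pow_closed[of x "3 ^ s"] nat_pow_closed[of y "3 ^ s"]
    unfolding lin_def by algebra
  finally show ?thesis .
qed

lemma lin_uminus:
  assumes "c \<in> carrier R" "y \<in> carrier R"
  shows "lin s c (\<ominus> y) = \<ominus> lin s c y"
  using assms by (simp add: lin_def odd_pow_uminus r_minus minus_add)

text \<open>
  As \<open>3 ^ s\<close> is odd, say \<open>2 * m + 1\<close>, a nonzero root \<open>y\<close> would exhibit \<open>\<ominus> c\<close> as the square of
  \<open>y ^ m\<close>.
\<close>
lemma lin_eq_zeroD:
  assumes c: "c \<in> carrier R" "\<not> is_square_in R (\<ominus> c)"
    and y: "y \<in> carrier R" "lin s c y = \<zero>"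
  shows "y = \<zero>"
proof (rule ccontr)
  assume nz: "y \<noteq> \<zero>"
  have "odd ((3::nat) ^ s)" by simp
  then obtain m where m: "(3::nat) ^ s = Suc (m + m)"
    by (metis oddE mult_2 Suc_eq_plus1)
  let ?w = "y [^] m"
  have "(?w \<otimes> ?w \<oplus> c) \<otimes> y = lin s c y"
    using c y unfolding lin_def m
    by (simp add: nat_pow_mult[symmetric] l_distr)
  then have "?w \<otimes> ?w \<oplus> c = \<zero>"
    using y c nz by (simp add: integral_iff)
  then have "\<ominus> c = ?w \<otimes> ?w"
    using c y by (simp add: minus_equality)
  then show False
    using c(2) y(1) unfolding is_square_in_def by blast
qed

lemma lin_inj:
  assumes "c \<in> carrier R" "\<not> is_square_in R (\<ominus> c)" "x \<in> carrier R" "y \<in> carrier R"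
    "lin s c x = lin s c y"
  shows "x = y"
proof -
  have "lin s c (x \<ominus> y) = \<zero>"
    unfolding lin_diff[OF assms(1,3,4)] assms(5)
    using lin_closed[OF assms(1,4)] by (simp only: r_right_minus_eq)
  then have "x \<ominus> y = \<zero>"
    by (rule lin_eq_zeroD[OF assms(1,2) minus_closed[OF assms(3,4)]])
  then show ?thesis
    using assms(3,4) by (simp only: r_right_minus_eq)
qed

text \<open>
  The equation \<open>L(a y) = e L(y)\<close> reads \<open>A y\<^sup>q = B y\<close> with \<open>A = a\<^sup>q - e\<close> and \<open>B = c (e - a)\<close>. If
  \<open>A\<close> were zero then so would be \<open>B\<close>, and \<open>a\<^sup>q = e = a\<close> would force \<open>a = \<plusminus>1\<close>. With \<open>A\<close> nonzero,
  the quotient of any two nonzero solutions is fixed by the \<open>q\<close>-th power, hence equal to \<open>\<plusminus>1\<close>.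
\<close>
lemma lin_scaling_unique:
  assumes c: "c \<in> carrier R" "c \<noteq> \<zero>" and s: "s \<ge> 1" "coprime s d"
    and a: "a \<in> carrier R" "a \<noteq> \<zero>" "a \<notin> {\<one>, \<ominus> \<one>}" and e: "e \<in> carrier R"
    and x: "x \<in> carrier R" "x \<noteq> \<zero>" "lin s c (a \<otimes> x) = e \<otimes> lin s c x"
    and y: "y \<in> carrier R" "y \<noteq> \<zero>" "lin s c (a \<otimes> y) = e \<otimes> lin s c y"
  shows "x \<in> {y, \<ominus> y}"
proof -
  let ?q = "(3::nat) ^ s"
  define A where "A = a [^] ?q \<ominus> e"
  define B where "B = c \<otimes> (e \<ominus> a)"
  have AB: "A \<in> carrier R" "B \<in> carrier R"
    using a c e by (auto simp: A_def B_def)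
  have lineq: "A \<otimes> w [^] ?q = B \<otimes> w"
    if w: "w \<in> carrier R" "lin s c (a \<otimes> w) = e \<otimes> lin s c w" for w
  proof -
    define P Q where "P = a [^] ?q" and "Q = w [^] ?q"
    have PQ: "P \<in> carrier R" "Q \<in> carrier R" using a w by (auto simp: P_def Q_def)
    have eq: "P \<otimes> Q \<oplus> c \<otimes> (a \<otimes> w) = e \<otimes> (Q \<oplus> c \<otimes> w)"
      using w(2) a(1) w(1) by (simp add: lin_def nat_pow_distrib P_def Q_def)
    have "(P \<ominus> e) \<otimes> Q = (P \<otimes> Q \<oplus> c \<otimes> (a \<otimes> w)) \<ominus> e \<otimes> Q \<ominus> c \<otimes> (a \<otimes> w)"
      using PQ a(1) c(1) e w(1) by algebra
    also have "\<dots> = c \<otimes> (e \<ominus> a) \<otimes> w"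
      unfolding eq using PQ a(1) c(1) e w(1) by algebra
    finally show ?thesis by (simp add: A_def B_def P_def Q_def)
  qed
  have "A \<noteq> \<zero>"
  proof
    assume A0: "A = \<zero>"
    then have "B \<otimes> x = \<zero>"
      using lineq[OF x(1,3)] x(1) by simp
    then have "B = \<zero>" using x AB by (simp add: integral_iff)
    then have "e = a" using c a e by (simp add: B_def integral_iff)
    moreover have "a [^] ?q = e" using A0 a e by (simp add: A_def)
    ultimately show False
      using frobenius_fixed[OF a(1,2) s] a(3) by simp
  qed
  define X Y where "X = x [^] ?q" and "Y = y [^] ?q"
  have XY: "X \<in> carrier R" "Y \<in> carrier R" using x y by (auto simp: X_def Y_def)
  have "A \<otimes> (X \<otimes> y) = (A \<otimes> X) \<otimes> y" using AB XY y(1) by (simp add: m_assoc)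
  also have "\<dots> = (B \<otimes> x) \<otimes> y" using lineq[OF x(1,3)] by (simp add: X_def)
  also have "\<dots> = (B \<otimes> y) \<otimes> x" using AB x(1) y(1) by algebra
  also have "\<dots> = (A \<otimes> Y) \<otimes> x" using lineq[OF y(1,3)] by (simp add: Y_def)
  also have "\<dots> = A \<otimes> (Y \<otimes> x)" using AB XY x(1) by (simp add: m_assoc)
  finally have cross: "X \<otimes> y = Y \<otimes> x"
    using \<open>A \<noteq> \<zero>\<close> AB XY x(1) y(1) by (simp add: m_lcancel)
  define z where "z = x \<otimes> inv y"
  have iy: "inv y \<in> carrier R" "y \<otimes> inv y = \<one>"
    using y(1,2) by (auto simp: field_Units)
  then have "inv y \<noteq> \<zero>"
    using y(1) by auto
  have xz: "x = z \<otimes> y"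
    using iy x(1) y(1) by (simp add: z_def m_assoc m_comm[of "inv y"])
  have z: "z \<in> carrier R" "z \<noteq> \<zero>"
    using x(1,2) iy \<open>inv y \<noteq> \<zero>\<close> by (auto simp: z_def integral_iff)
  have "(z [^] ?q) \<otimes> (Y \<otimes> y) = z \<otimes> (Y \<otimes> y)"
    using cross z y(1) XY unfolding X_def xz
    by (simp add: nat_pow_distrib Y_def[symmetric] m_assoc m_comm m_lcomm)
  moreover have "Y \<otimes> y \<noteq> \<zero>"
    using y by (simp add: Y_def integral_iff pow_nonzero)
  ultimately have "z [^] ?q = z"
    using z XY y(1) m_rcancel[of "Y \<otimes> y" "z [^] ?q" z] by simp
  then have "z \<in> {\<one>, \<ominus> \<one>}" by (rule frobenius_fixed[OF z s])
  then show ?thesis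
    using xz y(1) by (auto simp: l_minus)
qed

end

section \<open>A criterion for APN permutations of $\mathbb{Z}/n\mathbb{Z}$\<close>

text \<open>
  Only the upper bound has to be checked. If the bound were never attained for the shift 1, the
  derivative \<open>x \<mapsto> F(x + 1) - F(x)\<close> would be injective on a set of \<open>n\<close> elements while
  missing the value 0, a contradiction.
\<close>
lemma APN_permutationI:
  assumes n: "n \<ge> 2"
    and bij: "bij_betw F (carrier (Zmod n)) (carrier (Zmod n))"
    and le2: "\<And>u v. u \<in> {0<..<int n} \<Longrightarrow> v \<in> {0..<int n} \<Longrightarrow>
        card {x \<in> {0..<int n}. F ((x + u) mod int n) = (F x + v) mod int n} \<le> 2"
  shows "APN_permutation n F"
proof -
  interpret residues "int n" "Zmod n"
    using n by unfold_locales auto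
  have car: "carrier (Zmod n) = {0..<int n}"
    by (auto simp: res_carrier_eq)
  have F: "F x \<in> {0..<int n}" if "x \<in> {0..<int n}" for x
    using bij that by (auto simp: car bij_betw_def)
  define S where "S u v = {x \<in> {0..<int n}. F ((x + u) mod int n) = (F x + v) mod int n}"
    for u v
  have diff_iff: "F (x \<oplus>\<^bsub>Zmod n\<^esub> u) \<ominus>\<^bsub>Zmod n\<^esub> F x = v \<longleftrightarrow>
      F ((x + u) mod int n) = (F x + v) mod int n"
    if x: "x \<in> {0..<int n}" and v: "v \<in> {0..<int n}" for x u v
  proof -
    define y where "y = (x + u) mod int n"
    have y: "F y \<in> {0..<int n}" using F[of y] n by (simp add: y_def)
    have "(F y - F x) mod int n = v \<longleftrightarrow> [F y - F x = v] (mod int n)"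
      using v by (simp add: cong_def)
    also have "\<dots> \<longleftrightarrow> [F y = F x + v] (mod int n)"
      by (metis add.commute cong_diff_iff_cong_0 diff_diff_eq)
    also have "\<dots> \<longleftrightarrow> F y = (F x + v) mod int n"
      using y by (simp add: cong_def)
    finally show ?thesis
      by (simp add: a_minus_def res_neg_eq res_add_eq y_def mod_simps)
  qed
  define N where "N u v = card {x \<in> carrier (Zmod n). F (x \<oplus>\<^bsub>Zmod n\<^esub> u) \<ominus>\<^bsub>Zmod n\<^esub> F x = v}" for u v
  have N_eq: "N u v = card (S u v)" if "v \<in> {0..<int n}" for u v
  proof -
    have "{x \<in> carrier (Zmod n). F (x \<oplus>\<^bsub>Zmod n\<^esub> u) \<ominus>\<^bsub>Zmod n\<^esub> F x = v} = S u v"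
      unfolding S_def car by (intro Collect_cong conj_cong refl diff_iff that)
    then show ?thesis by (simp add: N_def)
  qed
  define C where "C = {N u v | u v. u \<in> carrier (Zmod n) - {\<zero>\<^bsub>Zmod n\<^esub>} \<and> v \<in> carrier (Zmod n)}"
  have C_le: "m \<le> 2" if m: "m \<in> C" for m
  proof -
    obtain u v where uv: "u \<in> carrier (Zmod n) - {\<zero>\<^bsub>Zmod n\<^esub>}" "v \<in> carrier (Zmod n)"
      "m = N u v"
      using m unfolding C_def by blast
    have v: "v \<in> {0..<int n}" and u: "u \<in> {0<..<int n}"
      using uv(1,2) unfolding car res_zero_eq by auto
    show ?thesis
      unfolding uv(3) N_eq[OF v] S_def by (rule le2[OF u v])
  qed
  define D where "D x = (F ((x + 1) mod int n) - F x) mod int n" for x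
  have "D ` {0..<int n} \<subseteq> {0<..<int n}"
  proof
    fix v assume "v \<in> D ` {0..<int n}"
    then obtain x where x: "x \<in> {0..<int n}" "v = D x" by auto
    have "D x \<noteq> 0"
    proof
      assume "D x = 0"
      then have "F ((x + 1) mod int n) mod int n = F x mod int n"
        unfolding D_def by (simp only: mod_eq_dvd_iff dvd_eq_mod_eq_0)
      moreover have x1: "(x + 1) mod int n \<in> {0..<int n}" using n by simp
      ultimately have "F ((x + 1) mod int n) = F x"
        using F[OF x1] F[OF x(1)] by simp
      moreover have "inj_on F {0..<int n}"
        using bij unfolding car by (rule bij_betw_imp_inj_on)
      ultimately have "(x + 1) mod int n = x"
        using x1 x(1) by (metis inj_onD)
      then have "[x + 1 = x + 0] (mod int n)"
        using x(1) by (simp add: cong_def)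
      then have "[1 = 0] (mod int n)"
        by (simp only: cong_add_lcancel)
      then show False using n by (simp add: cong_def)
    qed
    moreover have "D x \<ge> 0" "D x < int n" using n by (simp_all add: D_def)
    ultimately show "v \<in> {0<..<int n}" using x(2) by simp
  qed
  then have "card (D ` {0..<int n}) \<le> card {0<..<int n}"
    by (intro card_mono) auto
  also have "\<dots> < card {0..<int n}" using n by simp
  finally have "\<not> inj_on D {0..<int n}"
    using pigeonhole by blast
  then obtain x y where xy: "x \<in> {0..<int n}" "y \<in> {0..<int n}" "x \<noteq> y" "D x = D y"
    by (auto simp: inj_on_def)
  have "w \<in> S 1 (D w)" if "w \<in> {0..<int n}" for w
    using that F[of "(w + 1) mod int n"] n by (simp add: S_def D_def mod_simps)
  from this[of x] this[of y] have "{x, y} \<subseteq> S 1 (D x)"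
    using xy by simp
  moreover have "finite (S 1 (D x))"
    unfolding S_def by (rule finite_subset[of _ "{0..<int n}"]) auto
  ultimately have "card {x, y} \<le> card (S 1 (D x))"
    by (intro card_mono)
  then have ge2: "card (S 1 (D x)) \<ge> 2"
    using xy(3) by simp
  have D: "D x \<in> {0..<int n}" using n by (simp add: D_def)
  have "card (S 1 (D x)) \<le> 2"
    unfolding S_def using le2[of 1 "D x"] D n by simp
  then have "card (S 1 (D x)) = 2" using ge2 by simp
  moreover have "card (S 1 (D x)) \<in> C"
  proof -
    have "1 \<in> carrier (Zmod n) - {\<zero>\<^bsub>Zmod n\<^esub>}" "D x \<in> carrier (Zmod n)"
      using n D unfolding car res_zero_eq by auto
    then show ?thesis
      unfolding C_def N_eq[OF D, symmetric] by blast
  qed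
  ultimately have "2 \<in> C" by simp
  moreover have "finite C"
    using C_le by (meson atMost_iff finite_atMost finite_subset subsetI)
  ultimately have "Max C = 2"
    using C_le by (intro Max_eqI)
  then show ?thesis
    using bij unfolding APN_permutation_def APN_def N_def[symmetric] C_def[symmetric] by (auto simp: bij_betw_def)
qed

section \<open>Discrete logarithms up to sign\<close>

locale field_dlog = field R for R (structure) +
  fixes \<alpha> :: 'a and n :: nat
  assumes primitive: "primitive_element R \<alpha>"
    and order_odd: "order R = 2 * n + 1"
    and n_pos: "n > 0"
begin

lemma alpha_closed [simp]: "\<alpha> \<in> carrier R"
  and alpha_nonzero: "\<alpha> \<noteq> \<zero>"
  using primitive by (auto simp: primitive_element_def)

lemma alpha_pow_nonzero [simp]: "\<alpha> [^] (i::nat) \<noteq> \<zero>"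
  by (rule pow_nonzero[OF alpha_closed alpha_nonzero])

lemma finite_car: "finite (carrier R)"
  using order_odd by (intro finite_carrier_if_order_pos) simp

lemma alpha_pow_eq_iff:
  "\<alpha> [^] (i::nat) = \<alpha> [^] (j::nat) \<longleftrightarrow> [i = j] (mod 2 * n)"
proof -
  interpret M: group "mult_of R" by (rule field_mult_group)
  have a: "\<alpha> \<in> carrier (mult_of R)" using alpha_nonzero by simp
  have "M.ord \<alpha> = card (carrier (mult_of R))"
    using M.generate_pow_card[OF a] primitive by (simp add: primitive_element_def)
  also have "\<dots> = 2 * n"
    using order_mult_of[OF finite_car] order_odd by (simp add: order_def)
  finally have ord: "M.ord \<alpha> = 2 * n" .
  have "\<alpha> [^]\<^bsub>mult_of R\<^esub> int i = \<alpha> [^]\<^bsub>mult_of R\<^esub> int j \<longleftrightarrow> int (2 * n) dvd int i - int j"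
    using M.int_pow_eq[OF a, of "int i" "int j"]
    by (simp only: ord dvd_diff_commute[of _ "int j" "int i"])
  then show ?thesis
    by (simp add: int_pow_int nat_pow_mult_of flip: cong_int_iff cong_iff_dvd_diff)
qed

lemma eq_or_uminus_iff_squares:
  assumes "x \<in> carrier R" "y \<in> carrier R"
  shows "x \<in> {y, \<ominus> y} \<longleftrightarrow> x \<otimes> x = y \<otimes> y"
proof
  assume "x \<otimes> x = y \<otimes> y"
  have "(x \<ominus> y) \<otimes> (x \<oplus> y) = x \<otimes> x \<ominus> y \<otimes> y"
    using assms by algebra
  also have "\<dots> = \<zero>"
    using assms \<open>x \<otimes> x = y \<otimes> y\<close> by simp
  finally have "x \<ominus> y = \<zero> \<or> x \<oplus> y = \<zero>"
    using assms by (simp add: integral_iff)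
  then show "x \<in> {y, \<ominus> y}"
    using assms by (auto simp: minus_equality)
qed (use assms in \<open>auto simp: l_minus r_minus\<close>)

text \<open>
  Equality up to sign is equality of squares, and \<open>\<alpha>\<^sup>2\<close> has order \<open>n\<close>.
\<close>
lemma alpha_pow_class_iff:
  "\<alpha> [^] (i::nat) \<in> {\<alpha> [^] (j::nat), \<ominus> (\<alpha> [^] j)} \<longleftrightarrow> [i = j] (mod n)"
proof -
  have "\<alpha> [^] i \<in> {\<alpha> [^] j, \<ominus> (\<alpha> [^] j)} \<longleftrightarrow> \<alpha> [^] (2 * i) = \<alpha> [^] (2 * j)"
    by (simp add: eq_or_uminus_iff_squares nat_pow_mult mult_2 del: insert_iff)
  also have "\<dots> \<longleftrightarrow> [i = j] (mod n)"
    by (simp add: alpha_pow_eq_iff cong_def flip: mult_mod_right)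
  finally show ?thesis .
qed

lemma ex_alpha_pow:
  assumes "y \<in> carrier R" "y \<noteq> \<zero>"
  shows "\<exists>i::nat. y = \<alpha> [^] i"
proof -
  interpret M: group "mult_of R" by (rule field_mult_group)
  have "y \<in> generate (mult_of R) {\<alpha>}"
    using assms primitive by (simp add: primitive_element_def)
  then show ?thesis
    using M.generate_pow_on_finite_carrier[of \<alpha>] finite_mult_of[OF finite_car] alpha_nonzero
    by (auto simp: nat_pow_mult_of)
qed

definition dlog :: "'a \<Rightarrow> int" where
  "dlog y = (THE j. j \<in> carrier (Zmod n) \<and> y \<in> {\<alpha> [^] j, \<ominus> (\<alpha> [^] j)})"

lemma dlog_alpha_pow: "dlog (\<alpha> [^] (i::nat)) = int (i mod n)"
  unfolding dlog_def
proof (rule the_equality)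
  have "\<alpha> [^] i \<in> {\<alpha> [^] (i mod n), \<ominus> (\<alpha> [^] (i mod n))}"
    by (simp only: alpha_pow_class_iff) (simp add: cong_def)
  then show "int (i mod n) \<in> carrier (Zmod n) \<and>
      \<alpha> [^] i \<in> {\<alpha> [^] int (i mod n), \<ominus> (\<alpha> [^] int (i mod n))}"
    using n_pos by (simp add: residue_ring_def int_pow_int)
next
  fix j assume j: "j \<in> carrier (Zmod n) \<and> \<alpha> [^] i \<in> {\<alpha> [^] j, \<ominus> (\<alpha> [^] j)}"
  then obtain m where m: "j = int m" "m < n"
    by (auto simp: residue_ring_def elim: nonneg_int_cases)
  then have "[i = m] (mod n)"
    using j by (simp only: int_pow_int alpha_pow_class_iff)
  then show "j = int (i mod n)"
    using m by (simp add: cong_def)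
qed

text \<open>
  Addition in \<open>\<int>/n\<close> corresponds to multiplication up to sign in the field. The case \<open>v = 0\<close> says
  when two logarithms coincide.
\<close>
lemma dlog_eq_iff:
  assumes "y \<in> carrier R" "y \<noteq> \<zero>" "z \<in> carrier R" "z \<noteq> \<zero>"
  shows "dlog y = (dlog z + int v) mod int n \<longleftrightarrow> y \<in> {\<alpha> [^] v \<otimes> z, \<ominus> (\<alpha> [^] v \<otimes> z)}"
proof -
  obtain i j :: nat where "y = \<alpha> [^] i" "z = \<alpha> [^] j"
    using assms ex_alpha_pow by metis
  moreover have "(int (j mod n) + int v) mod int n = int ((v + j) mod n)"
    by (simp add: zmod_int mod_simps add.commute)
  ultimately show ?thesis
    by (simp add: dlog_alpha_pow alpha_pow_class_iff nat_pow_mult cong_def del: insert_iff of_nat_mod)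
qed

lemma dlog_range:
  assumes "y \<in> carrier R" "y \<noteq> \<zero>"
  shows "dlog y \<in> {0..<int n}"
  using ex_alpha_pow[OF assms] n_pos by (auto simp: dlog_alpha_pow)

end

section \<open>The APN permutations\<close>

locale apn_setting = char3_field R d + field_dlog R \<alpha> n
  for R (structure) and d \<alpha> n +
  fixes k s :: nat and c :: 'a
  assumes n_ge_2: "n \<ge> 2"
    and k: "coprime k n"
    and c: "c \<in> carrier R" "c \<noteq> \<zero>" "\<not> is_square_in R (\<ominus> c)"
    and s: "s \<ge> 1" "coprime s d"
begin

text \<open>A field element representing, up to sign, the image of \<open>i\<close> under the APN map.\<close>
definition image_rep :: "nat \<Rightarrow> 'a" where
  "image_rep i = lin s c (\<alpha> [^] (i * k))"

lemma lin_nonzero: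
  assumes "y \<in> carrier R" "y \<noteq> \<zero>"
  shows "lin s c y \<noteq> \<zero>"
  using lin_eq_zeroD[OF c(1,3) assms(1)] assms(2) by blast

lemma image_rep_closed [simp]: "image_rep i \<in> carrier R" and image_rep_nonzero [simp]: "image_rep i \<noteq> \<zero>"
  using c(1) lin_nonzero by (auto simp: image_rep_def)

lemma lin_class:
  assumes "x \<in> carrier R" "y \<in> carrier R"
  shows "lin s c x \<in> {lin s c y, \<ominus> lin s c y} \<longleftrightarrow> x \<in> {y, \<ominus> y}"
proof -
  have "lin s c x = lin s c z \<longleftrightarrow> x = z" if "z \<in> carrier R" for z
    using lin_inj[OF c(1,3) assms(1) that] by blast
  then show ?thesis
    using assms c(1) by (simp flip: lin_uminus)
qed

lemma apn_F_eq: "apn_F n R \<alpha> k c s (int i) = dlog (image_rep i)"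
proof -
  have "(\<alpha> [^] int i) [^] (k * 3 ^ s) = (\<alpha> [^] (i * k)) [^] ((3::nat) ^ s)"
    by (simp add: int_pow_int nat_pow_pow mult.assoc)
  moreover have "(\<alpha> [^] int i) [^] k = \<alpha> [^] (i * k)"
    by (simp add: int_pow_int nat_pow_pow)
  ultimately show ?thesis
    unfolding apn_F_def dlog_def image_rep_def lin_def by (simp only:)
qed

lemma pow_k_class_iff:
  "\<alpha> [^] (i * k) \<in> {\<alpha> [^] (j * k), \<ominus> (\<alpha> [^] (j * k))} \<longleftrightarrow> [i = j] (mod n)"
  using k by (simp only: alpha_pow_class_iff cong_mult_rcancel_nat)

lemma image_rep_class_iff:
  "image_rep i \<in> {image_rep j, \<ominus> image_rep j} \<longleftrightarrow> [i = j] (mod n)"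
  unfolding image_rep_def by (simp only: lin_class alpha_closed nat_pow_closed pow_k_class_iff)

lemma bij_apn_F:
  "bij_betw (apn_F n R \<alpha> k c s) (carrier (Zmod n)) (carrier (Zmod n))"
proof -
  let ?F = "apn_F n R \<alpha> k c s"
  have car: "carrier (Zmod n) = {0..<int n}"
    by (auto simp: residue_ring_def)
  have nat: "\<exists>i<n. x = int i" if "x \<in> {0..<int n}" for x
    using that by (auto intro!: exI[of _ "nat x"])
  have into: "?F ` {0..<int n} \<subseteq> {0..<int n}"
  proof
    fix y assume "y \<in> ?F ` {0..<int n}"
    then obtain i where "y = ?F (int i)"
      using nat by blast
    then show "y \<in> {0..<int n}"
      using dlog_range[of "image_rep i"] by (simp only: apn_F_eq image_rep_closed image_rep_nonzero not_False_eq_True simp_thms)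
  qed
  have "inj_on ?F {0..<int n}"
  proof (rule inj_onI)
    fix x y assume xy: "x \<in> {0..<int n}" "y \<in> {0..<int n}" "?F x = ?F y"
    obtain i j where ij: "x = int i" "y = int j" "i < n" "j < n"
      using xy nat by metis
    have "dlog (image_rep i) = (dlog (image_rep j) + int 0) mod int n"
      using xy(3) dlog_range[of "image_rep j"] by (simp add: ij apn_F_eq)
    then have "image_rep i \<in> {image_rep j, \<ominus> image_rep j}"
      by (subst (asm) dlog_eq_iff) simp_all
    then show "x = y"
      using ij by (simp only: image_rep_class_iff) (simp add: cong_def)
  qed
  then show ?thesis
    using endo_inj_surj[OF _ into] by (auto simp: car bij_betw_def)
qed

text \<open>
  The logarithm turns the difference equation into \<open>L(a y) = \<plusminus>b L(y)\<close>, and each sign admits at most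
  one class \<open>\<plusminus>y\<close>.
\<close>
lemma card_derivative_le_2:
  assumes u: "u \<in> {0<..<int n}" and v: "v \<in> {0..<int n}"
  shows "card {x \<in> {0..<int n}. apn_F n R \<alpha> k c s ((x + u) mod int n) =
           (apn_F n R \<alpha> k c s x + v) mod int n} \<le> 2"
    (is "card ?S \<le> 2")
proof -
  obtain t w where t: "u = int t" "0 < t" "t < n" and w: "v = int w"
    using u v by (metis atLeastLessThan_iff greaterThanLessThan_iff nonneg_int_cases of_nat_0_less_iff of_nat_less_iff order_less_imp_le)
  define a where "a = \<alpha> [^] (t * k)"
  define b where "b = \<alpha> [^] w"
  have a: "a \<in> carrier R" "a \<noteq> \<zero>" and b: "b \<in> carrier R"
    by (simp_all add: a_def b_def)
  have "a \<notin> {\<one>, \<ominus> \<one>}"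
    using pow_k_class_iff[of t 0] t by (simp add: a_def cong_def)
  define T where
    "T e = {i \<in> {..<n}. lin s c (a \<otimes> \<alpha> [^] (i * k)) = e \<otimes> image_rep i}" for e
  have "card (T e) \<le> 1" if e: "e \<in> carrier R" for e
  proof -
    have "i = j" if "i \<in> T e" "j \<in> T e" for i j
    proof -
      have "\<alpha> [^] (i * k) \<in> {\<alpha> [^] (j * k), \<ominus> (\<alpha> [^] (j * k))}"
        using that lin_scaling_unique[OF c(1,2) s a \<open>a \<notin> _\<close> e]
        by (simp add: T_def image_rep_def del: insert_iff)
      then have "[i = j] (mod n)" by (simp only: pow_k_class_iff)
      then show ?thesis using that by (simp add: T_def cong_def)
    qed
    moreover have "finite (T e)" by (simp add: T_def)
    ultimately show ?thesis by (simp add: card_le_Suc0_iff_eq)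
  qed
  then have T: "card (T b) \<le> 1" "card (T (\<ominus> b)) \<le> 1"
    using b by simp_all
  have "?S \<subseteq> int ` (T b \<union> T (\<ominus> b))"
  proof
    fix x assume x: "x \<in> ?S"
    then obtain i where i: "x = int i" "i < n"
      by (auto elim: nonneg_int_cases)
    have "(x + u) mod int n = int ((i + t) mod n)"
      by (simp add: i t zmod_int)
    then have "dlog (image_rep ((i + t) mod n)) = (dlog (image_rep i) + int w) mod int n"
      using x by (simp add: i w apn_F_eq del: of_nat_mod)
    then have "image_rep ((i + t) mod n) \<in> {b \<otimes> image_rep i, \<ominus> (b \<otimes> image_rep i)}"
      by (subst (asm) dlog_eq_iff) (simp_all add: b_def)
    moreover have "image_rep (i + t) \<in> {image_rep ((i + t) mod n), \<ominus> image_rep ((i + t) mod n)}"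
      by (simp only: image_rep_class_iff) (simp add: cong_def)
    ultimately have "image_rep (i + t) \<in> {b \<otimes> image_rep i, \<ominus> b \<otimes> image_rep i}"
      using b by (auto simp: l_minus)
    moreover have "image_rep (i + t) = lin s c (a \<otimes> \<alpha> [^] (i * k))"
      by (simp add: image_rep_def a_def nat_pow_mult distrib_right add.commute)
    ultimately show "x \<in> int ` (T b \<union> T (\<ominus> b))"
      using i by (auto simp: T_def)
  qed
  then have "card ?S \<le> card (T b \<union> T (\<ominus> b))"
    by (intro surj_card_le) (auto simp: T_def)
  also have "\<dots> \<le> card (T b) + card (T (\<ominus> b))"
    by (rule card_Un_le)
  finally show ?thesis using T by simp
qed

lemma apn_F_APN_permutation: "APN_permutation n (apn_F n R \<alpha> k c s)"
  using n_ge_2 bij_apn_F card_derivative_le_2 by (rule APN_permutationI)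

end

theorem theorem5:
  fixes d n :: nat
  assumes "d \<ge> 14" and "[d = 14] (mod 4620)" and "n = (3 ^ d - 1) div 2"
  shows "(\<forall>(K :: 'a ring) \<alpha> k c s.
            field K \<and> order K = 3 ^ d \<and> primitive_element K \<alpha> \<and>
            k > 0 \<and> coprime k n \<and>
            c \<in> carrier K - {\<zero>\<^bsub>K\<^esub>} \<and> \<not> is_square_in K (\<ominus>\<^bsub>K\<^esub> c) \<and>
            s \<ge> 1 \<and> coprime s d \<longrightarrow>
            APN_permutation n (apn_F n K \<alpha> k c s)) \<and>
         order (Zmod n) = n \<and>
         (\<forall>q \<in> {n - 1, n + 1, n + 2, n + 3, n + 4}. \<not> primepow q) \<and>
         (\<forall>p. prime p \<longrightarrow> n \<noteq> 2 * p)"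
proof (intro conjI)
  note bounds = half_three_power_bounds[OF assms(1,3)]
  show "\<forall>(K :: 'a ring) \<alpha> k c s.
            field K \<and> order K = 3 ^ d \<and> primitive_element K \<alpha> \<and>
            k > 0 \<and> coprime k n \<and>
            c \<in> carrier K - {\<zero>\<^bsub>K\<^esub>} \<and> \<not> is_square_in K (\<ominus>\<^bsub>K\<^esub> c) \<and>
            s \<ge> 1 \<and> coprime s d \<longrightarrow>
            APN_permutation n (apn_F n K \<alpha> k c s)"
  proof (intro allI impI)
    fix K :: "'a ring" and \<alpha> k c s
    assume *: "field K \<and> order K = 3 ^ d \<and> primitive_element K \<alpha> \<and>
      k > 0 \<and> coprime k n \<and>
      c \<in> carrier K - {\<zero>\<^bsub>K\<^esub>} \<and> \<not> is_square_in K (\<ominus>\<^bsub>K\<^esub> c) \<and>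
      s \<ge> 1 \<and> coprime s d"
    then interpret field K by blast
    interpret apn_setting K d \<alpha> n k s c
      by unfold_locales (use * bounds in auto)
    show "APN_permutation n (apn_F n K \<alpha> k c s)"
      by (rule apn_F_APN_permutation)
  qed
  show "order (Zmod n) = n"
    by (simp add: order_def residue_ring_def)
  show "\<forall>q \<in> {n - 1, n + 1, n + 2, n + 3, n + 4}. \<not> primepow q"
    by (rule half_three_power_neighbours_not_primepow[OF assms])
  show "\<forall>p. prime p \<longrightarrow> n \<noteq> 2 * p"
    using half_three_power_neq_two_prime[OF assms] by blast
qed

end
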